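(* Let $Y$ be a locally compact Hausdorff space, $\lambda$ a measure on it and $Z$ a locally compact subspace of $Y$. Then the following are equivalent: (i) for every nonnegative $f\in C_c(Y)$, $\int_Y f\,d\lambda=\int_Z f\,d\lambda$; (ii) for every $f\in C_c(Y)$, $\int_Y f\,d\lambda=\int_Z f\,d\lambda$; (iii) for every $f\in\mathcal L^1(Y)$, $\int_Y f\,d\lambda=\int_Z f\,d\lambda$; (iv) for every nonnegative $f\in\mathcal L^1(Y)$, $\int_Y f\,d\lambda=\int_Z f\,d\lambda$; (v) every $y\in Y$ has a neighbourhood $V\subseteq Y$ such that $\lambda(V\cap(Y-Z))=0$.
   Context: All measures are positive, Radon and $\sigma$-finite. $\mathcal L^1(Y)$ denotes the $\lambda$-integrable functions on $Y$. A locally compact subspace $Z$ of a locally compact Hausdorff space $Y$ is locally closed, hence Borel, and $\int_Z f\,d\lambda=\int_Y f\chi_Z\,d\lambda$, where $\chi_Z$ is the characteristic function of $Z$. *)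

theory Defs
  imports "HOL-Analysis.Analysis"
begin

text \<open>
  A Radon measure is defined on a \<open>\<sigma>\<close>-algebra containing the Borel sets (not necessarily equal
  to it, so that both Borel measures and their completions are covered), is finite on compact sets
  and is inner regular with respect to compact sets. For a \<open>\<sigma>\<close>-finite measure on a locally compact
  Hausdorff space this last condition follows from the other common convention (outer regular on
  measurable sets, inner regular on open sets). Note that \<open>space M = UNIV\<close> follows from the
  first condition.
\<close>
definition radon_measure :: "'a::topological_space measure \<Rightarrow> bool" where
  "radon_measure M \<longleftrightarrow>
     sets borel \<subseteq> sets M \<and>
     (\<forall>K. compact K \<longrightarrow> emeasure M K < \<infinity>) \<and>
     (\<forall>A\<in>sets M. emeasure M A = (SUP K\<in>{K. compact K \<and> K \<subseteq> A}. emeasure M K))"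

definition Cc :: "('a::topological_space \<Rightarrow> complex) set" where
  "Cc = {f. continuous_on UNIV f \<and> compact (closure {y. f y \<noteq> 0})}"

end

theory Submission
  imports Defs
begin

text \<open>
  Everything reduces to the single assertion \<open>\<lambda>(Y - Z) = 0\<close>. It implies all of the
  integral identities, and it follows from the local condition on neighbourhoods because any
  compact subset of \<open>Y - Z\<close> is covered by finitely many of the given neighbourhoods, hence is
  null, and \<open>\<lambda>\<close> is inner regular (lemma \<open>null_if_locally_null\<close>).

  The weakest identity, the one for nonnegative \<open>f \<in> C\<^sub>c(Y)\<close>, gives the local condition back:
  a locally compact Hausdorff space has a nonnegative bump function \<open>g\<close> in \<open>C\<^sub>c(Y)\<close> around each
  point, and \<open>\<integral>\<^bsub>Y-Z\<^esub> g d\<lambda> = 0\<close> forces the open neighbourhood \<open>{g > 0}\<close> to meet \<open>Y - Z\<close> in a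
  null set. The other implications are inclusions between classes of functions, once compactly
  supported continuous functions are known to be integrable.
\<close>

lemma Hausdorff_space_euclidean_t2: "Hausdorff_space (euclidean :: 'a::t2_space topology)"
  unfolding Hausdorff_space_def by (simp add: disjnt_def) (metis hausdorff)

text \<open>Such a subspace is open in its closure, so it is the intersection of an open set with a
  closed one.\<close>

lemma locally_compact_imp_borel:
  fixes Z :: "'a::t2_space set"
  assumes "locally_compact_space (top_of_set Z)"
  shows "Z \<in> sets borel"
proof -
  have "openin (top_of_set (closure Z)) Z"
    using locally_compact_subspace_openin_closure_of[OF Hausdorff_space_euclidean_t2, of Z] assms
    by simp
  then obtain T where "open T" "Z = closure Z \<inter> T"
    by (auto simp: openin_open)
  then show ?thesis
    by (metis borel_closed borel_open closed_closure sets.Int)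
qed

text \<open>The function separates \<open>y\<close> from the complement of a relatively compact open neighbourhood;
  it exists because a locally compact Hausdorff space is completely regular.\<close>

lemma locally_compact_bump_function:
  fixes y :: "'a::t2_space"
  assumes "locally_compact_space (euclidean :: 'a topology)"
  obtains g :: "'a \<Rightarrow> real"
  where "continuous_on UNIV g" "\<And>x. 0 \<le> g x" "0 < g y" "compact (closure {x. g x \<noteq> 0})"
proof -
  have "\<exists>U K. open U \<and> compact K \<and> y \<in> U \<and> U \<subseteq> K"
    using assms by (simp add: locally_compact_space_def)
  then obtain U K where U: "open U" "compact K" "y \<in> U" "U \<subseteq> K"
    by blast
  have "completely_regular_space (euclidean :: 'a topology)"
    using locally_compact_regular_imp_completely_regular_space assms
      Hausdorff_space_euclidean_t2 by blast
  then obtain f :: "'a \<Rightarrow> real" where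
    f: "continuous_map euclidean (top_of_set {0..1}) f" "f y = 0" "f ` (- U) \<subseteq> {1}"
    unfolding completely_regular_space_def
    using U(1,3) by (metis Compl_iff Diff_iff UNIV_I closed_Compl closed_closedin topspace_euclidean)
  have cont: "continuous_on UNIV f" and bounds: "\<And>x. f x \<in> {0..1}"
    using f(1) by (auto simp: continuous_map_in_subtopology)
  have "closure {x. 1 - f x \<noteq> 0} \<subseteq> K"
  proof (rule closure_minimal)
    show "{x. 1 - f x \<noteq> 0} \<subseteq> K"
      using f(3) U(4) by auto
    show "closed K"
      using U(2) by (rule compact_imp_closed)
  qed
  then have "compact (closure {x. 1 - f x \<noteq> 0})"
    using U(2) by (metis closed_closure compact_Int_closed inf.absorb_iff2)
  moreover have "continuous_on UNIV (\<lambda>x. 1 - f x)"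
    by (intro continuous_intros cont)
  ultimately show thesis
    using that[of "\<lambda>x. 1 - f x"] bounds f(2) by auto
qed

lemma Cc_integrable:
  fixes f :: "'a::t2_space \<Rightarrow> complex"
  assumes "radon_measure M" and "f \<in> Cc"
  shows "integrable M f"
proof -
  let ?K = "closure {y. f y \<noteq> 0}"
  have borel: "sets borel \<subseteq> sets M"
    and fin: "\<And>K. compact K \<Longrightarrow> emeasure M K < \<infinity>"
    using assms(1) by (auto simp: radon_measure_def)
  have cont: "continuous_on UNIV f" and cpt: "compact ?K"
    using assms(2) by (auto simp: Cc_def)
  obtain B where B: "\<And>x. x \<in> ?K \<Longrightarrow> norm (f x) \<le> B"
    using compact_imp_bounded[OF compact_continuous_image[OF continuous_on_subset[OF cont] cpt]]
    by (auto simp: bounded_iff)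
  have meas: "f \<in> borel_measurable M"
    using borel_measurable_continuous_onI[OF cont] borel sets.sets_into_space[of UNIV M]
    by (auto simp: measurable_def)
  show ?thesis
  proof (rule integrableI_bounded_set)
    show "?K \<in> sets M"
      using borel by auto
    show "AE x in M. x \<notin> ?K \<longrightarrow> f x = 0"
      using subsetD[OF closure_subset, of _ "{y. f y \<noteq> 0}"] by (intro AE_I2) blast
    show "AE x in M. x \<in> ?K \<longrightarrow> norm (f x) \<le> B"
      using B by (intro AE_I2) blast
  qed (use meas fin[OF cpt] in simp_all)
qed

text \<open>Compactness bounds the measure of compact subsets of \<open>A\<close> by a finite sum of zeros, and inner
  regularity passes from these subsets to \<open>A\<close>.\<close>

lemma null_if_locally_null:
  fixes M :: "'a::t2_space measure"
  assumes radon: "radon_measure M" and A: "A \<in> sets M"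
    and loc: "\<And>y. \<exists>V. y \<in> interior V \<and> V \<inter> A \<in> null_sets M"
  shows "A \<in> null_sets M"
proof -
  have compact_null: "emeasure M K = 0" if K: "compact K" "K \<subseteq> A" for K
  proof -
    obtain V where V: "\<And>y. y \<in> interior (V y)" "\<And>y. V y \<inter> A \<in> null_sets M"
      using loc by metis
    obtain D where D: "finite D" "K \<subseteq> (\<Union>y\<in>D. interior (V y))"
    proof (rule compactE_image[OF K(1), of UNIV "\<lambda>y. interior (V y)"])
      show "K \<subseteq> (\<Union>y. interior (V y))"
        using V(1) by (intro subsetI UN_I[OF UNIV_I])
    qed simp_all
    have "(\<Union>y\<in>D. V y \<inter> A) \<in> null_sets M"
      using D(1) V(2) by (intro null_sets_UN' countable_finite) auto
    moreover have "K \<subseteq> (\<Union>y\<in>D. V y \<inter> A)"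
    proof
      fix x assume "x \<in> K"
      then obtain y where "y \<in> D" "x \<in> interior (V y)"
        using D(2) by blast
      then show "x \<in> (\<Union>y\<in>D. V y \<inter> A)"
        using subsetD[OF interior_subset] K(2) \<open>x \<in> K\<close> by (intro UN_I IntI) auto
    qed
    ultimately show ?thesis
      using emeasure_eq_0 null_setsD1 null_setsD2 by blast
  qed
  have "emeasure M A = (SUP K\<in>{K. compact K \<and> K \<subseteq> A}. emeasure M K)"
    using radon A by (auto simp: radon_measure_def)
  also have "\<dots> \<le> 0"
    by (rule SUP_least) (simp add: compact_null)
  finally show ?thesis
    using A by (simp add: null_sets_def)
qed

lemma lebesgue_integral_eq_set_integral_if_Compl_null:
  fixes f :: "'a \<Rightarrow> 'b::{banach, second_countable_topology}"
  assumes [measurable]: "integrable M f" "A \<in> sets M" and "- A \<in> null_sets M"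
  shows "(LINT x|M. f x) = (LINT x:A|M. f x)"
  unfolding set_lebesgue_integral_def
proof (rule integral_cong_AE)
  show "AE x in M. f x = indicator A x *\<^sub>R f x"
    using AE_not_in[OF assms(3)] by eventually_elim auto
qed measurable

text \<open>The set integral over \<open>{g > 0} - A\<close> is the integral of \<open>g\<close> minus its integral over \<open>A\<close>, hence
  zero although the integrand is strictly positive there.\<close>

lemma positive_set_minus_null_if_integral_eq_set_integral:
  fixes g :: "'a \<Rightarrow> real"
  assumes g[measurable]: "integrable M g" and A[measurable]: "A \<in> sets M"
    and nonneg: "\<And>x. 0 \<le> g x" and space: "space M = UNIV"
    and eq: "(LINT x|M. g x) = (LINT x:A|M. g x)"
  shows "{x. 0 < g x} - A \<in> null_sets M"
proof (rule null_if_pos_func_has_zero_int[OF g])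
  have "{x \<in> space M. 0 < g x} \<in> sets M"
    by measurable
  then show "{x. 0 < g x} - A \<in> sets M"
    using space by auto
  have "(LINT x:{x. 0 < g x} - A|M. g x) = (LINT x|M. g x - indicator A x *\<^sub>R g x)"
    unfolding set_lebesgue_integral_def
    by (rule Bochner_Integration.integral_cong)
      (use nonneg in \<open>auto simp: indicator_def order.strict_iff_order\<close>)
  also have "\<dots> = 0"
    using eq integrable_mult_indicator[OF A g] g
    by (simp add: set_lebesgue_integral_def)
  finally show "(LINT x:{x. 0 < g x} - A|M. g x) = 0" .
qed auto

theorem lemma1p12:
  fixes lam :: "'a::t2_space measure" and Z :: "'a set"
  assumes "locally_compact_space (euclidean :: 'a topology)"
    and "radon_measure lam"
    and "sigma_finite_measure lam"
    and "locally_compact_space (top_of_set Z)"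
  shows
    "let i = (\<forall>f\<in>Cc. (\<forall>y. f y \<in> \<real>\<^sub>\<ge>\<^sub>0) \<longrightarrow> (LINT y|lam. f y) = (LINT y:Z|lam. f y));
         ii = (\<forall>f\<in>Cc. (LINT y|lam. f y) = (LINT y:Z|lam. f y));
         iii = (\<forall>f::'a \<Rightarrow> complex. integrable lam f \<longrightarrow>
                  (LINT y|lam. f y) = (LINT y:Z|lam. f y));
         iv = (\<forall>f::'a \<Rightarrow> complex. integrable lam f \<longrightarrow> (\<forall>y. f y \<in> \<real>\<^sub>\<ge>\<^sub>0) \<longrightarrow>
                  (LINT y|lam. f y) = (LINT y:Z|lam. f y));
         v = (\<forall>y. \<exists>V. y \<in> interior V \<and> V \<inter> (UNIV - Z) \<in> null_sets lam)
     in (i \<longleftrightarrow> ii) \<and> (ii \<longleftrightarrow> iii) \<and> (iii \<longleftrightarrow> iv) \<and> (iv \<longleftrightarrow> v)"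
proof -
  define i where "i \<longleftrightarrow> (\<forall>f\<in>Cc. (\<forall>y. f y \<in> \<real>\<^sub>\<ge>\<^sub>0) \<longrightarrow> (LINT y|lam. f y) = (LINT y:Z|lam. f y))"
  define ii where "ii \<longleftrightarrow> (\<forall>f\<in>Cc. (LINT y|lam. f y) = (LINT y:Z|lam. f y))"
  define iii where "iii \<longleftrightarrow> (\<forall>f::'a \<Rightarrow> complex. integrable lam f \<longrightarrow>
    (LINT y|lam. f y) = (LINT y:Z|lam. f y))"
  define iv where "iv \<longleftrightarrow> (\<forall>f::'a \<Rightarrow> complex. integrable lam f \<longrightarrow> (\<forall>y. f y \<in> \<real>\<^sub>\<ge>\<^sub>0) \<longrightarrow>
    (LINT y|lam. f y) = (LINT y:Z|lam. f y))"
  define v where "v \<longleftrightarrow> (\<forall>y. \<exists>V. y \<in> interior V \<and> V \<inter> (UNIV - Z) \<in> null_sets lam)"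
  have borel: "sets borel \<subseteq> sets lam"
    using assms(2) by (simp add: radon_measure_def)
  have Z: "Z \<in> sets lam" "- Z \<in> sets lam"
    using borel locally_compact_imp_borel[OF assms(4)] borel_comp by auto
  have space: "space lam = UNIV"
    using sets.sets_into_space[of UNIV lam] subsetD[OF borel, of UNIV] by auto
  have Cc_int: "integrable lam f" if "f \<in> Cc" for f
    using Cc_integrable[OF assms(2) that] .
  have "iii" if v
  proof -
    have "- Z \<in> null_sets lam"
      using null_if_locally_null[OF assms(2) Z(2)] \<open>v\<close>
      by (simp add: v_def Compl_eq_Diff_UNIV)
    then show ?thesis
      using lebesgue_integral_eq_set_integral_if_Compl_null Z(1) unfolding iii_def by blast
  qed
  moreover have "iii \<Longrightarrow> ii" "ii \<Longrightarrow> i" "iii \<Longrightarrow> iv" "iv \<Longrightarrow> i"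
    using Cc_int by (auto simp: i_def ii_def iii_def iv_def)
  moreover have "v" if i
    unfolding v_def
  proof
    fix y
    obtain g :: "'a \<Rightarrow> real" where g: "continuous_on UNIV g" "\<And>x. 0 \<le> g x" "0 < g y"
        "compact (closure {x. g x \<noteq> 0})"
      using locally_compact_bump_function[OF assms(1)] by metis
    have g_Cc: "(\<lambda>x. complex_of_real (g x)) \<in> Cc"
      using g by (auto simp: Cc_def intro!: continuous_intros)
    then have "(LINT x|lam. complex_of_real (g x)) = (LINT x:Z|lam. complex_of_real (g x))"
      using \<open>i\<close> g(2) unfolding i_def
      by (metis nonneg_Reals_of_real_iff)
    then have "(LINT x|lam. g x) = (LINT x:Z|lam. g x)"
      by (simp add: set_integral_complex_of_real)
    moreover have "integrable lam g"
      using Cc_int[OF g_Cc] by (simp add: complex_of_real_integrable_eq)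
    ultimately have "{x. 0 < g x} - Z \<in> null_sets lam"
      using positive_set_minus_null_if_integral_eq_set_integral Z(1) g(2) space by metis
    moreover have "open {x. 0 < g x}"
      using g(1) by (intro open_Collect_less continuous_on_const)
    ultimately show "\<exists>V. y \<in> interior V \<and> V \<inter> (UNIV - Z) \<in> null_sets lam"
      using g(3) by (intro exI[of _ "{x. 0 < g x}"]) (simp add: interior_open Diff_eq)
  qed
  ultimately have "(i \<longleftrightarrow> ii) \<and> (ii \<longleftrightarrow> iii) \<and> (iii \<longleftrightarrow> iv) \<and> (iv \<longleftrightarrow> v)"
    by blast
  then show ?thesis
    unfolding Let_def i_def ii_def iii_def iv_def v_def .
qed

end
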